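(* For $n\ge1$, \[ \sum_{j=0}^{n}\binom{n}{j}(x+j)^{n-1}=n!\,(n-1)!\sum_{l=0}^{n-1}\sum_{j=0}^{n}\frac{\binom{n}{j}S_2(l+n,n)}{(l+n)!\,(n-l-1)!}B_{n-1-l}^{(n)}(x+j). \] Moreover, \[ \sum_{j=0}^{n}\binom{n}{j}j^{n-1}=n!\,(n-1)!\sum_{l=0}^{n-1}\sum_{j=0}^{n}\frac{\binom{n}{j}S_2(l+n,n)}{(l+n)!\,(n-l-1)!}B_{n-1-l}^{(n)}(j). \]
   Context: For real $r$, the Bernoulli polynomials of order $r$ are defined by $\left(\frac{t}{e^t-1}\right)^re^{xt}=\sum_{n\ge0}B_n^{(r)}(x)\frac{t^n}{n!}$. $S_2(n,k)$ denotes the Stirling numbers of the second kind. The convention $0^0=1$ is used. *)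

theory Defs
  imports
    Complex_Main
    "HOL-Computational_Algebra.Formal_Power_Series"
    "HOL-Combinatorics.Stirling"
begin

text \<open>
  Real powers of a formal power series with constant term 1, via the binomial series
  \<open>f\<^sup>r = (1 + (f - 1))\<^sup>r = (\<Sum>k. (r gchoose k) * (f - 1)\<^sup>k)\<close>.
  If the constant term of \<open>f\<close> is not 1, the value is meaningless.
\<close>

definition fps_real_power :: "'a::real_field fps \<Rightarrow> real \<Rightarrow> 'a fps" where
  "fps_real_power f r = fps_binomial (of_real r) oo (f - 1)"

definition bernoulli_gf :: "real \<Rightarrow> 'a::real_field \<Rightarrow> 'a fps" where
  "bernoulli_gf r x = fps_real_power (fps_X / (fps_exp 1 - 1)) r * fps_exp x"

definition bernoulli_poly :: "real \<Rightarrow> nat \<Rightarrow> 'a::real_field \<Rightarrow> 'a" where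
  "bernoulli_poly r n x = fact n * fps_nth (bernoulli_gf r x) n"

lemma bernoulli_base_mult:
  "fps_X / (fps_exp 1 - 1) * (fps_exp 1 - 1) = (fps_X :: 'a::real_field fps)"
proof -
  have 1: "fps_nth (fps_exp 1 - 1 :: 'a fps) 1 \<noteq> 0"
    by simp
  then have "subdegree (fps_exp 1 - 1 :: 'a fps) \<le> 1"
    by (rule subdegree_leI)
  moreover have "(fps_exp 1 - 1 :: 'a fps) \<noteq> 0"
    using 1 by (metis fps_zero_nth)
  ultimately have "(fps_exp 1 - 1 :: 'a fps) dvd fps_X"
    by (simp only: fps_dvd_iff fps_X_neq_zero subdegree_fps_X not_False_eq_True)
  then show ?thesis
    by (rule dvd_div_mult_self)
qed

text \<open>The base series has constant term 1, so its real power above is legitimate.\<close>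

lemma bernoulli_base_nth_0: "fps_nth (fps_X / (fps_exp 1 - 1) :: 'a::real_field fps) 0 = 1"
proof -
  have "fps_nth (fps_X / (fps_exp 1 - 1) * (fps_exp 1 - 1) :: 'a fps) 1 = 1"
    by (simp only: bernoulli_base_mult fps_X_nth) simp
  then show ?thesis
    by (simp only: fps_mult_nth_1) simp
qed

lemma fps_real_power_of_nat:
  assumes "fps_nth f 0 = 1"
  shows "fps_real_power f (real n) = f ^ n"
proof -
  have "fps_real_power f (real n) = (1 + fps_X) ^ n oo (f - 1)"
    by (simp add: fps_real_power_def fps_binomial_of_nat)
  also have "\<dots> = ((1 + fps_X) oo (f - 1)) ^ n"
    using assms by (intro fps_compose_power [symmetric]) simp
  also have "(1 + fps_X) oo (f - 1) = f"
    using assms by (simp add: fps_compose_add_distrib)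
  finally show ?thesis .
qed

end

theory Submission
  imports Defs
begin

text \<open>
  The identity holds summand by summand in \<open>j\<close>: multiplying the generating function
  \<open>(t / (e\<^sup>t - 1))\<^sup>n e\<^sup>y\<^sup>t\<close> by
  \<open>((e\<^sup>t - 1) / t)\<^sup>n = n! (\<Sum>l. S\<^sub>2(l + n, n) t\<^sup>l / (l + n)!)\<close> gives \<open>e\<^sup>y\<^sup>t\<close>,
  and comparing coefficients expresses \<open>y\<^sup>m\<close> through the polynomials \<open>B\<^sub>m\<^sub>-\<^sub>l\<^sup>(\<^sup>n\<^sup>)(y)\<close>.
\<close>

text \<open>Since E = e^t - 1 satisfies E' = E + 1, differentiating E^(j+1) gives (j+1)(E^(j+1) +
  E^j). On coefficients this is the Stirling recurrence; it involves the exponents j+1 and j, so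
  \<open>k\<close> stays arbitrary in the induction.\<close>

lemma fps_nth_exp_minus_1_power:
  "fps_nth ((fps_exp 1 - 1 :: 'a::field_char_0 fps) ^ k) m =
     fact k * of_nat (Stirling m k) / fact m"
proof (induction m arbitrary: k)
  case 0
  show ?case
    by (cases k) (simp_all add: fps_power_zeroth)
next
  case (Suc m)
  show ?case
  proof (cases k)
    case 0
    then show ?thesis by simp
  next
    case (Suc j)
    let ?E = "fps_exp 1 - 1 :: 'a fps"
    have "fps_deriv (?E ^ Suc j) = of_nat (Suc j) * (?E ^ Suc j + ?E ^ j)"
      unfolding fps_deriv_power by (simp add: fps_of_nat algebra_simps del: of_nat_Suc)
    then have "fps_nth (fps_deriv (?E ^ Suc j)) m =
        fps_nth (of_nat (Suc j) * (?E ^ Suc j + ?E ^ j)) m"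
      by simp
    then have "of_nat (Suc m) * fps_nth (?E ^ Suc j) (Suc m) =
        of_nat (Suc j) * (fps_nth (?E ^ Suc j) m + fps_nth (?E ^ j) m)"
      by (simp only: fps_deriv_nth fps_mult_of_nat_nth fps_add_nth Suc_eq_plus1)
    also have "\<dots> = fact (Suc j) * of_nat (Stirling (Suc m) (Suc j)) / fact m"
      unfolding Suc.IH by (simp add: field_simps)
    finally have "fps_nth (?E ^ Suc j) (Suc m) =
        fact (Suc j) * of_nat (Stirling (Suc m) (Suc j)) / fact m / of_nat (Suc m)"
      by (metis nonzero_mult_div_cancel_left of_nat_neq_0)
    then show ?thesis
      using \<open>k = Suc j\<close> by (simp add: mult.commute)
  qed
qed

lemma bernoulli_gf_of_nat:
  "bernoulli_gf (real n) y = (fps_X / (fps_exp 1 - 1)) ^ n * fps_exp y"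
  by (simp add: bernoulli_gf_def fps_real_power_of_nat bernoulli_base_nth_0)

text \<open>The shift by \<open>n\<close> divides by t^n, so the second factor is ((e^t - 1)/t)^n,
  the inverse of the power in the generating function.\<close>

lemma bernoulli_gf_mult_shift:
  "bernoulli_gf (real n) y * fps_shift n ((fps_exp 1 - 1) ^ n) = fps_exp (y :: 'a::real_field)"
proof -
  let ?E = "fps_exp 1 - 1 :: 'a fps"
  have "?E ^ n = fps_shift n (?E ^ n) * fps_X ^ n"
  proof (rule fps_ext)
    fix m
    \<comment> \<open>Nothing is lost by the shift: for m < n the coefficient vanishes because
      S_2(m, n) = 0.\<close>
    show "fps_nth (?E ^ n) m = fps_nth (fps_shift n (?E ^ n) * fps_X ^ n) m"
      by (simp add: fps_X_power_mult_right_nth fps_nth_exp_minus_1_power)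
  qed
  then have "(fps_X / ?E) ^ n * fps_shift n (?E ^ n) * fps_X ^ n = (fps_X / ?E * ?E) ^ n"
    by (simp only: power_mult_distrib mult.assoc)
  also have "\<dots> = 1 * fps_X ^ n"
    by (simp only: bernoulli_base_mult mult_1)
  finally have "(fps_X / ?E) ^ n * fps_shift n (?E ^ n) = 1"
    by simp
  then show ?thesis
    unfolding bernoulli_gf_of_nat by (metis mult.assoc mult.commute mult_1)
qed

text \<open>The order \<open>n\<close> is independent of the exponent \<open>m\<close>: every order
  yields an expansion of the same power.\<close>

lemma power_eq_sum_bernoulli_poly:
  fixes y :: "'a::real_field"
  shows "y ^ m = fact n * fact m *
    (\<Sum>l=0..m. of_nat (Stirling (l + n) n) / (fact (l + n) * fact (m - l)) *
       bernoulli_poly (real n) (m - l) y)"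
proof -
  have "y ^ m / fact m = fps_nth (fps_shift n ((fps_exp 1 - 1) ^ n) * bernoulli_gf (real n) y) m"
    by (simp only: mult.commute bernoulli_gf_mult_shift fps_exp_nth of_nat_fact)
  also have "\<dots> = (\<Sum>l=0..m. fact n * (of_nat (Stirling (l + n) n) /
      (fact (l + n) * fact (m - l)) * bernoulli_poly (real n) (m - l) y))"
    unfolding fps_mult_nth fps_shift_nth fps_nth_exp_minus_1_power bernoulli_poly_def
    by (intro sum.cong) simp_all
  finally have "y ^ m = fact m * \<dots>"
    by (simp add: field_simps)
  then show ?thesis
    by (simp only: sum_distrib_left [symmetric] mult.assoc mult.left_commute)
qed

theorem theorem9:
  fixes n :: nat and x :: "'a::real_field"
  assumes "n \<ge> 1"
  shows
    "(\<Sum>j=0..n. of_nat (n choose j) * (x + of_nat j) ^ (n - 1)) =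
       fact n * fact (n - 1) *
       (\<Sum>l=0..n-1. \<Sum>j=0..n.
          of_nat (n choose j) * of_nat (Stirling (l + n) n) / (fact (l + n) * fact (n - l - 1)) *
          bernoulli_poly (real n) (n - 1 - l) (x + of_nat j))
     \<and>
     (\<Sum>j=0..n. of_nat (n choose j) * (of_nat j :: 'a) ^ (n - 1)) =
       fact n * fact (n - 1) *
       (\<Sum>l=0..n-1. \<Sum>j=0..n.
          of_nat (n choose j) * of_nat (Stirling (l + n) n) / (fact (l + n) * fact (n - l - 1)) *
          bernoulli_poly (real n) (n - 1 - l) (of_nat j :: 'a))"
proof -
  have *: "(\<Sum>j=0..n. of_nat (n choose j) * (y + of_nat j) ^ (n - 1)) =
      fact n * fact (n - 1) *
      (\<Sum>l=0..n-1. \<Sum>j=0..n.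
         of_nat (n choose j) * of_nat (Stirling (l + n) n) / (fact (l + n) * fact (n - l - 1)) *
         bernoulli_poly (real n) (n - 1 - l) (y + of_nat j))" for y :: 'a
  proof -
    \<comment> \<open>Each summand is expanded with exponent n - 1 and order n;
      \<open>diff_right_commute\<close> identifies n - 1 - l with n - l - 1.\<close>
    have "(\<Sum>j=0..n. of_nat (n choose j) * (y + of_nat j) ^ (n - 1)) =
        (\<Sum>j=0..n. fact n * fact (n - 1) * (\<Sum>l=0..n-1.
          of_nat (n choose j) * of_nat (Stirling (l + n) n) / (fact (l + n) * fact (n - l - 1)) *
          bernoulli_poly (real n) (n - 1 - l) (y + of_nat j)))"
      by (subst power_eq_sum_bernoulli_poly [of _ "n - 1" n])
        (simp add: sum_distrib_left mult_ac diff_right_commute)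
    then show ?thesis
      by (simp only: sum_distrib_left [symmetric] sum.swap [of _ "{0..n}" "{0..n-1}"])
  qed
  \<comment> \<open>The second identity is the case y = 0.\<close>
  show ?thesis
    using * [of x] * [of 0] by (simp only: add_0)
qed

end
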